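(* For all $n\geq1$, \[ j_{n}(123)=\sum_{k=0}^{\lfloor (n-1)/2\rfloor}\frac{1}{2k+1}\binom{n-k-1}{k}\binom{n}{2k}. \]
   Context: A permutation of a finite set $S$ of positive integers is a word in which each element of $S$ appears exactly once; $\mathfrak{S}_n$ is the set of permutations of $\{1,\dots,n\}$. For a permutation $\pi$ and a letter $x$ of $\pi$, $\rho_\pi(x)$ is the maximal consecutive subword of $\pi$ consisting of the letters immediately to the right of $x$ that are all larger than $x$. $\pi$ is Jacobi if $|\rho_\pi(x)|$ is even for all letters $x$. A permutation $\pi$ avoids a pattern $\sigma$ if no subword of $\pi$ has standardization (relative order) $\sigma$. $j_n(123)$ is the number of $123$-avoiding Jacobi permutations in $\mathfrak{S}_n$. *)

theory Defs
  imports
    Complex_Main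
    "HOL-Library.Sublist"
    "HOL-Combinatorics.Multiset_Permutations"
begin

text \<open>Permutations are written as words, i.e. as distinct lists; the permutations of
  \<open>{1..n}\<close> are the elements of \<^term>\<open>permutations_of_set {1..n::nat}\<close>.\<close>

text \<open>The letter \<open>x\<close> is assumed to occur in \<open>\<pi>\<close> exactly once.\<close>

definition rho :: "nat list \<Rightarrow> nat \<Rightarrow> nat list" where
  "rho \<pi> x = takeWhile (\<lambda>y. x < y) (tl (dropWhile (\<lambda>y. y \<noteq> x) \<pi>))"

definition jacobi :: "nat list \<Rightarrow> bool" where
  "jacobi \<pi> \<longleftrightarrow> (\<forall>x\<in>set \<pi>. even (length (rho \<pi> x)))"

definition standardize :: "nat list \<Rightarrow> nat list" where
  "standardize w = map (\<lambda>x. card {y \<in> set w. y \<le> x}) w"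

text \<open>Subwords in the sense of pattern avoidance need not be consecutive.\<close>

definition avoids :: "nat list \<Rightarrow> nat list \<Rightarrow> bool" where
  "avoids \<pi> \<sigma> \<longleftrightarrow> \<not> (\<exists>w. subseq w \<pi> \<and> standardize w = \<sigma>)"

definition num_jacobi_avoiding :: "nat \<Rightarrow> nat list \<Rightarrow> nat" where
  "num_jacobi_avoiding n \<sigma> =
     card {\<pi> \<in> permutations_of_set {1..n}. jacobi \<pi> \<and> avoids \<pi> \<sigma>}"

end

theory Submission
  imports Defs "HOL-Computational_Algebra.Formal_Power_Series"
begin

text \<open>In a 123-avoiding permutation the left-to-right minima decrease and so do the other letters,
  hence \<^term>\<open>rho \<pi> x\<close> is the block between \<open>x\<close> and the next minimum if \<open>x\<close> is a left-to-right
  minimum, and is empty otherwise. The permutation is Jacobi iff all these blocks have even length.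
  Reading the letters \<open>n, \<dots>, 1\<close> and recording \<open>e = 0\<close> for a letter that is not a minimum and
  \<open>e = 1 + |block|\<close> for a minimum encodes it as a Dyck path in which each up step is followed
  by \<open>e\<close> down steps, \<open>e\<close> being zero or odd. With \<open>\<phi> = 1 + x / (1 - x\<^sup>2)\<close> the cycle lemma counts these
  paths as the coefficient of \<open>x\<^sup>n\<close> in \<open>\<phi>\<^bsup>n+1\<^esup> / (n + 1)\<close>.\<close>

unbundle fps_syntax

section \<open>Recursive forms of avoidance and of the Jacobi condition\<close>

fun av123 :: "nat list \<Rightarrow> bool" where
  "av123 [] \<longleftrightarrow> True"
| "av123 (x # w) \<longleftrightarrow> sorted_wrt (\<lambda>y z. \<not> (x < y \<and> y < z)) w \<and> av123 w"

fun even_runs :: "nat list \<Rightarrow> bool" where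
  "even_runs [] \<longleftrightarrow> True"
| "even_runs (x # w) \<longleftrightarrow> even (length (takeWhile (\<lambda>y. x < y) w)) \<and> even_runs w"

lemma standardize_eq_123_iff:
  "standardize w = [1, 2, 3] \<longleftrightarrow> (\<exists>x y z. w = [x, y, z] \<and> x < y \<and> y < z)"
proof
  assume *: "standardize w = [1, 2, 3]"
  then have "length w = 3"
    by (metis standardize_def length_map length_Cons list.size(3) numeral_3_eq_3)
  then obtain x y z where w: "w = [x, y, z]"
    by (auto simp: numeral_3_eq_3 length_Suc_conv)
  define c where "c v = card {u \<in> set w. u \<le> v}" for v
  have c: "c x = 1" "c y = 2" "c z = 3"
    using * by (simp_all add: standardize_def c_def w)
  have mono: "c u \<le> c v" if "u \<le> v" for u v
    unfolding c_def using that by (intro card_mono) auto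
  have "x < y" "y < z"
    using mono[of y x] mono[of z y] c by (auto simp: not_le[symmetric])
  then show "\<exists>x y z. w = [x, y, z] \<and> x < y \<and> y < z"
    using w by blast
next
  assume "\<exists>x y z. w = [x, y, z] \<and> x < y \<and> y < z"
  then obtain x y z where w: "w = [x, y, z]" "x < y" "y < z" by blast
  have "{u \<in> set w. u \<le> x} = {x}" "{u \<in> set w. u \<le> y} = {x, y}"
    "{u \<in> set w. u \<le> z} = {x, y, z}"
    using w by auto
  then show "standardize w = [1, 2, 3]"
    using w by (simp add: standardize_def)
qed

lemma sorted_wrt_iff_subseq:
  "sorted_wrt P w \<longleftrightarrow> (\<forall>y z. subseq [y, z] w \<longrightarrow> P y z)"
proof (induction w)
  case (Cons x w)
  have "subseq [y, z] (x # w) \<longleftrightarrow> subseq [y, z] w \<or> y = x \<and> z \<in> set w" for y z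
    by (metis subseq_Cons2_iff subseq_Cons' subseq_singleton_left)
  then show ?case
    using Cons by auto
qed simp

lemma avoids_123_iff: "avoids w [1, 2, 3] \<longleftrightarrow> av123 w"
proof -
  have "av123 w \<longleftrightarrow> (\<forall>x y z. subseq [x, y, z] w \<longrightarrow> \<not> (x < y \<and> y < z))"
  proof (induction w)
    case (Cons v w)
    have "subseq [x, y, z] (v # w) \<longleftrightarrow> subseq [x, y, z] w \<or> x = v \<and> subseq [y, z] w" for x y z
      by (metis subseq_Cons2_iff subseq_Cons')
    then show ?case
      unfolding av123.simps sorted_wrt_iff_subseq Cons by blast
  qed simp
  then show ?thesis
    unfolding avoids_def standardize_eq_123_iff by metis
qed

text \<open>\<open>rho\<close> looks only at the letters after \<open>x\<close>, so deleting the
  first letter leaves the runs of the others unchanged.\<close>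

lemma jacobi_iff_even_runs: "distinct w \<Longrightarrow> jacobi w \<longleftrightarrow> even_runs w"
proof (induction w)
  case (Cons v w)
  have "rho (v # w) x = rho w x" if "x \<in> set w" for x
    using that Cons.prems by (auto simp: rho_def)
  moreover have "rho (v # w) v = takeWhile (\<lambda>y. v < y) w"
    by (simp add: rho_def)
  ultimately show ?case
    using Cons by (auto simp: jacobi_def)
qed (simp add: jacobi_def)

section \<open>Building the words from the letters \<open>n\<close> down to 1\<close>

text \<open>The words that can still be appended when all letters above \<open>b\<close> have been processed and those
  in the decreasing list \<open>L\<close> are waiting to be used as letters that are not left-to-right minima.\<close>
definition words :: "nat \<Rightarrow> nat list \<Rightarrow> nat list set" where
  "words b L = {w. distinct w \<and> set w = {1..b} \<union> set L \<and> av123 w \<and> even_runs w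
                   \<and> (w = [] \<or> hd w \<le> b)}"

text \<open>Counts the paths of \<open>b\<close> steps \<open>1 - e\<close> from height
  \<open>h\<close> to 0 that stay nonnegative; the height is the number of waiting letters. In the
  first summand \<open>e = 0\<close> and the letter joins them; in the sum \<open>e = j + 1\<close>
  and the letter is a minimum whose block uses up \<open>j\<close> of them.\<close>

fun tails :: "nat \<Rightarrow> nat \<Rightarrow> nat" where
  "tails 0 h = (if h = 0 then 1 else 0)"
| "tails (Suc b) h = tails b (Suc h) + (\<Sum>j | j \<le> h \<and> even j. tails b (h - j))"

lemma finite_words: "finite (words b L)"
proof (rule finite_subset)
  show "words b L \<subseteq> permutations_of_set ({1..b} \<union> set L)"
    by (auto simp: words_def permutations_of_set_def)
qed simp

lemma sorted_wrt_greater_distinct: "sorted_wrt (>) (L :: nat list) \<Longrightarrow> distinct L"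
  by (induction L) auto

lemma sorted_wrt_greater_unique:
  fixes xs ys :: "nat list"
  assumes "sorted_wrt (>) xs" "sorted_wrt (>) ys" "set xs = set ys"
  shows "xs = ys"
proof -
  have "rev xs = rev ys"
    using assms by (intro strict_sorted_equal) (simp_all add: sorted_wrt_rev)
  then show ?thesis by simp
qed

text \<open>No letter of \<open>u\<close> has a larger letter to its right, so no 123 starts in
  \<open>u\<close>.\<close>

lemma av123_append:
  assumes "sorted_wrt (>) u" "\<forall>x\<in>set u. \<forall>y\<in>set w. \<not> x < y" "av123 w"
  shows "av123 (u @ w)"
  using assms
proof (induction u)
  case (Cons x u)
  have "sorted_wrt (\<lambda>y z. \<not> (x < y \<and> y < z)) (u @ w)"
  proof (rule sorted_wrt_mono_rel)
    show "sorted_wrt (\<lambda>y z. True) (u @ w)"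
      by (simp add: sorted_wrt_iff_nth_less)
  qed (use Cons.prems in auto)
  then show ?case using Cons by simp
qed simp

lemma av123_suffix: "av123 (u @ w) \<Longrightarrow> av123 w"
  by (induction u) auto

lemma even_runs_suffix: "even_runs (u @ w) \<Longrightarrow> even_runs w"
  by (induction u) auto

lemma even_runs_append:
  assumes "sorted_wrt (>) u" "even_runs w" "w = [] \<or> (\<forall>x\<in>set u. hd w < x)"
  shows "even_runs (u @ w)"
  using assms
proof (induction u)
  case (Cons x u)
  have "takeWhile (\<lambda>y. x < y) (u @ w) = []"
    using Cons.prems by (cases u; cases w) auto
  moreover have "even_runs (u @ w)"
    using Cons.prems by (intro Cons.IH) auto
  ultimately show ?case by simp
qed simp

text \<open>An ascent among these letters would form a 123 with \<open>x\<close>. This forces the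
  order in which waiting letters are used.\<close>

lemma av123_filter_decreasing:
  assumes "av123 (x # w)" "distinct w"
  shows "sorted_wrt (>) (filter (\<lambda>y. x < y) w)"
proof -
  have "sorted_wrt (\<lambda>y z. (x < y \<and> x < z) \<longrightarrow> y > z) w"
    unfolding sorted_wrt_iff_nth_less
  proof (intro allI impI)
    fix i j assume ij: "i < j" "j < length w" "x < w ! i \<and> x < w ! j"
    then have "\<not> w ! i < w ! j" "w ! i \<noteq> w ! j"
      using assms by (auto simp: sorted_wrt_iff_nth_less nth_eq_iff_index_eq)
    then show "w ! i > w ! j" by simp
  qed
  then show ?thesis
    by (induction w) auto
qed

text \<open>The block takes the largest waiting letters, so each of its letters exceeds everything
  after it.\<close>

lemma prepend_block_in_words:
  assumes L: "sorted_wrt (>) L" "\<forall>x\<in>set L. Suc b < x"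
    and j: "even j" "j \<le> length L" and w: "w \<in> words b (drop j L)"
  shows "Suc b # take j L @ w \<in> words (Suc b) L"
proof -
  define u v where "u = take j L" and "v = drop j L"
  have Luv: "L = u @ v" and lu: "length u = j"
    using j by (simp_all add: u_def v_def)
  have su: "sorted_wrt (>) u" "sorted_wrt (>) v" "\<forall>x\<in>set u. \<forall>y\<in>set v. y < x"
    using L(1) by (auto simp: Luv sorted_wrt_append)
  have bu: "\<forall>x\<in>set u. Suc b < x" "\<forall>x\<in>set v. Suc b < x"
    using L(2) by (auto simp: Luv)
  have wf: "distinct w" "set w = {1..b} \<union> set v" "av123 w" "even_runs w" "w = [] \<or> hd w \<le> b"
    using w by (auto simp: words_def v_def)
  have less: "y < x" if "x \<in> set u" "y \<in> set w" for x y
    using that su(3) bu wf(2) by force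
  have av: "av123 (u @ w)"
    using su(1) less wf(3) by (intro av123_append) force+
  have tw: "takeWhile (\<lambda>y. Suc b < y) (u @ w) = u"
    using bu(1) wf(5) by (cases w) (auto simp: takeWhile_append)
  have er: "even_runs (u @ w)"
    using su(1) wf(4,5) bu(1) by (intro even_runs_append) fastforce+
  \<comment> \<open>The first letter of \<open>w\<close> is at most \<open>b\<close>, so an ascent
    of \<open>w\<close> above \<open>Suc b\<close> would already form a 123 with it.\<close>
  have sw: "sorted_wrt (\<lambda>y z. \<not> (Suc b < y \<and> y < z)) w"
  proof (cases w)
    case (Cons a w')
    have "sorted_wrt (\<lambda>y z. \<not> (a < y \<and> y < z)) w'"
      using wf(3) Cons by simp
    then have "sorted_wrt (\<lambda>y z. \<not> (Suc b < y \<and> y < z)) w'"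
      using wf(5) Cons by (elim sorted_wrt_mono_rel[rotated]) auto
    then show ?thesis using wf(5) Cons by auto
  qed simp
  have sv: "sorted_wrt (\<lambda>y z. \<not> (Suc b < y \<and> y < z)) u"
    using su(1) by (elim sorted_wrt_mono_rel[rotated]) auto
  have "sorted_wrt (\<lambda>y z. \<not> (Suc b < y \<and> y < z)) (u @ w)"
    unfolding sorted_wrt_append using sv sw less by (auto dest: less_imp_not_less) 
  moreover have "distinct (Suc b # u @ w)"
  proof -
    have "Suc b \<notin> set u" "Suc b \<notin> set w"
      using bu wf(2) by auto
    moreover have "set u \<inter> set w = {}"
      using less by blast
    ultimately show ?thesis
      using sorted_wrt_greater_distinct[OF su(1)] wf(1) by simp
  qed
  moreover have "set (Suc b # u @ w) = {1..Suc b} \<union> set L"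
    using wf(2) by (auto simp: Luv)
  ultimately show ?thesis
    using av er tw j(1) lu unfolding words_def u_def[symmetric] by simp
qed

text \<open>The waiting letters must appear in decreasing order, so the run after
  \<open>Suc b\<close> is an initial segment of \<open>L\<close>.\<close>

lemma words_head_Suc:
  assumes L: "sorted_wrt (>) L" "\<forall>x\<in>set L. Suc b < x"
    and w: "Suc b # t \<in> words (Suc b) L"
  obtains j r where "even j" "j \<le> length L" "r \<in> words b (drop j L)" "t = take j L @ r"
proof -
  let ?P = "\<lambda>y. Suc b < y"
  have wf: "distinct t" "Suc b \<notin> set t" "insert (Suc b) (set t) = {1..Suc b} \<union> set L"
    "av123 (Suc b # t)" "even (length (takeWhile ?P t))" "even_runs t"
    using w by (auto simp: words_def)
  define u r where "u = takeWhile ?P t" and "r = dropWhile ?P t"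
  have t: "t = u @ r" by (simp add: u_def r_def)
  have sett: "set t = {1..b} \<union> set L"
  proof -
    have "Suc b \<notin> set L" using L(2) by blast
    moreover have "{1..Suc b} = insert (Suc b) {1..b}" by auto
    ultimately have "insert (Suc b) (set t) = insert (Suc b) ({1..b} \<union> set L)"
      "Suc b \<notin> {1..b} \<union> set L"
      using wf(3) by auto
    then show ?thesis using wf(2) by (metis insert_ident)
  qed
  have "sorted_wrt (>) (filter ?P t)"
    using av123_filter_decreasing wf(1,4) by blast
  moreover have "set (filter ?P t) = set L"
    using sett L(2) by auto
  ultimately have L_eq: "L = filter ?P t"
    using L(1) by (metis sorted_wrt_greater_unique)
  have fu: "filter ?P u = u"
    by (auto simp: u_def filter_id_conv dest: set_takeWhileD)
  define j where "j = length u"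
  have Lu: "L = u @ filter ?P r"
    unfolding L_eq by (simp add: t fu)
  have tk: "take j L = u" "drop j L = filter ?P r" "j \<le> length L"
    using Lu by (simp_all add: j_def)
  have "set r = {1..b} \<union> set (drop j L)"
  proof -
    have "set r = set t - set u"
      using wf(1) by (auto simp: t)
    moreover have "set (drop j L) = set L - set u"
    proof -
      have "set u \<union> set (drop j L) = set L"
        using append_take_drop_id[of j L] tk(1) by (metis set_append)
      moreover have "set u \<inter> set (drop j L) = {}"
        using set_take_disj_set_drop_if_distinct[of L j j] sorted_wrt_greater_distinct[OF L(1)] tk(1)
        by simp
      ultimately show ?thesis by blast
    qed
    moreover have "{1..b} \<inter> set u = {}"
      by (auto simp: u_def dest!: set_takeWhileD)
    ultimately show ?thesis
      using sett by auto
  qed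
  \<comment> \<open>The run stops at a letter that is at most \<open>Suc b\<close>, and
    \<open>Suc b\<close> is already used.\<close>
  moreover have "r = [] \<or> hd r \<le> b"
  proof (cases "r = []")
    case False
    then have "\<not> ?P (hd r)" "hd r \<in> set t"
      using hd_dropWhile[of ?P t] hd_in_set[of r] set_dropWhileD[of "hd r" ?P t]
      unfolding r_def by blast+
    then show ?thesis using wf(2) by (metis le_SucE not_less)
  qed simp
  moreover have "av123 r" "even_runs r" "distinct r"
    using wf(1,4,6) av123_suffix[of u r] even_runs_suffix[of u r] unfolding t by auto
  ultimately have "r \<in> words b (drop j L)"
    by (simp add: words_def)
  then show ?thesis
    using that[of j r] tk(1,3) t wf(5) unfolding j_def u_def by metis
qed


text \<open>Distinguish by the first letter. If it is not \<open>Suc b\<close>, it is smaller; then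
  \<open>Suc b\<close> is no left-to-right minimum and, being below all of \<open>L\<close>, joins
  that list at its end.\<close>

lemma words_Suc:
  assumes L: "sorted_wrt (>) L" "\<forall>x\<in>set L. Suc b < x"
  shows "words (Suc b) L = words b (L @ [Suc b]) \<union>
    (\<Union>j\<in>{j. j \<le> length L \<and> even j}. (\<lambda>w. Suc b # take j L @ w) ` words b (drop j L))"
    (is "_ = ?A \<union> ?B")
proof -
  have sets: "{1..Suc b} \<union> set L = {1..b} \<union> set (L @ [Suc b])" by auto
  show ?thesis
  proof (intro equalityI subsetI)
    fix w assume w: "w \<in> words (Suc b) L"
    then obtain x t where xt: "w = x # t"
      by (cases w) (auto simp: words_def)
    show "w \<in> ?A \<union> ?B"
    proof (cases "x = Suc b")
      case True
      obtain j r where "even j" "j \<le> length L" "r \<in> words b (drop j L)" "t = take j L @ r"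
        using words_head_Suc[OF L] w xt True by metis
      then show ?thesis using xt True by auto
    next
      case False
      then have "w \<in> ?A"
        using w xt unfolding words_def sets by simp
      then show ?thesis ..
    qed
  next
    fix w assume "w \<in> ?A \<union> ?B"
    then show "w \<in> words (Suc b) L"
    proof
      assume "w \<in> ?A"
      then show ?thesis unfolding words_def sets by auto
    next
      assume "w \<in> ?B"
      then show ?thesis using prepend_block_in_words[OF L] by auto
    qed
  qed
qed

lemma card_words:
  assumes "sorted_wrt (>) L" "\<forall>x\<in>set L. b < x"
  shows "card (words b L) = tails b (length L)"
  using assms
proof (induction b arbitrary: L)
  case 0
  have "words 0 L = (if L = [] then {[]} else {})"
  proof -
    have "w = []" if "w \<in> words 0 L" for w
    proof (rule ccontr)
      assume "w \<noteq> []"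
      then have "hd w \<in> set L" "hd w = 0"
        using that hd_in_set[of w] by (auto simp: words_def)
      then show False using 0(2) by auto
    qed
    moreover have "[] \<in> words 0 L \<longleftrightarrow> L = []"
      by (auto simp: words_def)
    ultimately show ?thesis by (cases "L = []") auto
  qed
  then show ?case by simp
next
  case (Suc b)
  let ?J = "{j. j \<le> length L \<and> even j}"
  let ?f = "\<lambda>j w. Suc b # take j L @ w"
  \<comment> \<open>The block length can be read off the word, which makes the images for different
    \<open>j\<close> disjoint.\<close>
  have len: "length (takeWhile (\<lambda>y. Suc b < y) (tl (?f j w))) = j"
    if "j \<in> ?J" "w \<in> words b (drop j L)" for j w
  proof -
    have "takeWhile (\<lambda>y. Suc b < y) (take j L @ w) = take j L"
    proof -
      have "\<forall>x\<in>set (take j L). Suc b < x"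
        using Suc.prems(2) by (auto dest: in_set_takeD)
      moreover have "takeWhile (\<lambda>y. Suc b < y) w = []"
        using that(2) by (cases w) (simp_all add: words_def)
      ultimately show ?thesis by (simp add: takeWhile_append2)
    qed
    then show ?thesis using that by simp
  qed
  have disj: "?f i ` words b (drop i L) \<inter> ?f j ` words b (drop j L) = {}"
    if "i \<in> ?J" "j \<in> ?J" "i \<noteq> j" for i j
  proof (rule ccontr)
    assume "\<not> ?thesis"
    then obtain w w' where "w \<in> words b (drop i L)" "w' \<in> words b (drop j L)" "?f i w = ?f j w'"
      by blast
    then show False
      using len[OF that(1)] len[OF that(2)] that(3) by metis
  qed
  have "words b (L @ [Suc b]) \<inter> (\<Union>j\<in>?J. ?f j ` words b (drop j L)) = {}"
    by (auto simp: words_def)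
  then have "card (words (Suc b) L) =
      card (words b (L @ [Suc b])) + card (\<Union>j\<in>?J. ?f j ` words b (drop j L))"
    unfolding words_Suc[OF Suc.prems] by (intro card_Un_disjoint) (auto simp: finite_words)
  also have "card (\<Union>j\<in>?J. ?f j ` words b (drop j L)) = (\<Sum>j\<in>?J. card (?f j ` words b (drop j L)))"
    using disj by (intro card_UN_disjoint) (auto simp: finite_words)
  also have "\<dots> = (\<Sum>j\<in>?J. tails b (length L - j))"
  proof (rule sum.cong)
    fix j
    have "card (?f j ` words b (drop j L)) = card (words b (drop j L))"
      by (intro card_image) (auto simp: inj_on_def)
    also have "\<dots> = tails b (length (drop j L))"
      using Suc.prems by (intro Suc.IH) (auto simp: sorted_wrt_drop dest!: in_set_dropD)
    finally show "card (?f j ` words b (drop j L)) = tails b (length L - j)" by simp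
  qed simp
  also have "card (words b (L @ [Suc b])) = tails b (Suc (length L))"
    using Suc.prems by (subst Suc.IH) (auto simp: sorted_wrt_append)
  finally show ?case by simp
qed

lemma num_jacobi_avoiding_123: "num_jacobi_avoiding n [1, 2, 3] = tails n 0"
proof -
  have "{\<pi> \<in> permutations_of_set {1..n}. jacobi \<pi> \<and> avoids \<pi> [1, 2, 3]} = words n []"
  proof -
    have "w = [] \<or> hd w \<le> n" if "set w = {1..n}" for w
      using that hd_in_set[of w] by auto
    then show ?thesis
      unfolding words_def permutations_of_set_def avoids_123_iff
      using jacobi_iff_even_runs by auto
  qed
  then show ?thesis
    using card_words[of "[]" n] by (simp add: num_jacobi_avoiding_def)
qed

section \<open>Coefficients of the powers of \<open>phi\<close>\<close>

text \<open>The coefficients of \<open>(1 - x\<^sup>2)\<^bsup>-m\<^esup>\<close>; truncated subtraction gives the right value for \<open>m = 0\<close>.\<close>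
definition geo2 :: "nat \<Rightarrow> real fps" where
  "geo2 m = Abs_fps (\<lambda>s. if even s then real ((s div 2 + m - 1) choose (s div 2)) else 0)"

text \<open>Generating function of the admissible \<open>e\<close>; \<open>phi ^ N\<close> counts
  sequences of \<open>N\<close> steps by the sum of their \<open>e\<close>.\<close>

definition phi :: "real fps" where
  "phi = 1 + fps_X * geo2 1"

lemma geo2_0: "geo2 0 = 1"
proof (rule fps_ext)
  fix s :: nat
  have "even s \<Longrightarrow> s > 0 \<Longrightarrow> s div 2 - 1 < s div 2" by presburger
  then show "geo2 0 $ s = 1 $ s"
    by (cases "s = 0") (auto simp: geo2_def)
qed

text \<open>Pascal's rule in each positive even degree.\<close>

lemma geo2_Suc_times: "(1 - fps_X ^ 2) * geo2 (Suc m) = geo2 m"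
proof (rule fps_ext)
  fix s
  show "((1 - fps_X ^ 2) * geo2 (Suc m)) $ s = geo2 m $ s"
  proof (cases "even s \<and> s > 0")
    case True
    then obtain i where s: "s = 2 * Suc i"
      by (metis evenE gr0_conv_Suc nat_0_less_mult_iff)
    have "s - 2 = 2 * i" "\<not> s < 2" using s by auto
    moreover have "s div 2 = Suc i" "even s" using s by auto
    ultimately show ?thesis
      by (simp add: left_diff_distrib fps_X_power_mult_nth geo2_def)
  next
    case False
    then show ?thesis
      by (auto simp: left_diff_distrib fps_X_power_mult_nth geo2_def)
  qed
qed

lemma geo2_1_power: "geo2 1 ^ m = geo2 m"
proof (induction m)
  case (Suc m)
  have "geo2 1 ^ Suc m = geo2 1 * ((1 - fps_X ^ 2) * geo2 (Suc m))"
    unfolding geo2_Suc_times Suc.IH[symmetric] by simp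
  also have "\<dots> = ((1 - fps_X ^ 2) * geo2 (Suc 0)) * geo2 (Suc m)"
    by (simp add: algebra_simps)
  also have "\<dots> = geo2 (Suc m)"
    by (simp add: geo2_Suc_times geo2_0)
  finally show ?case .
qed (simp add: geo2_0)

lemma phi_nth: "phi $ e = (if e = 0 \<or> odd e then 1 else 0)"
  by (cases e) (auto simp: phi_def geo2_def)

text \<open>In the binomial expansion \<open>m\<close> is the number of factors contributing an odd
  \<open>e\<close>; parity forces \<open>m = n - 2 * k\<close>.\<close>

lemma phi_power_nth:
  assumes "n \<ge> 1"
  shows "(phi ^ Suc n) $ n =
    (\<Sum>k = 0..(n - 1) div 2. real (Suc n choose (2 * k + 1)) * real ((n - k - 1) choose k))"
proof -
  have "phi ^ Suc n = (\<Sum>m\<le>Suc n. of_nat (Suc n choose m) * (fps_X ^ m * geo2 m))"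
    using binomial_ring[of "fps_X * geo2 1" 1 "Suc n"]
    by (simp add: phi_def add.commute power_mult_distrib geo2_1_power[unfolded One_nat_def] mult.assoc)
  then have "(phi ^ Suc n) $ n =
      (\<Sum>m\<le>Suc n. real (Suc n choose m) * (if n < m then 0 else geo2 m $ (n - m)))"
    by (simp add: fps_sum_nth fps_X_power_mult_nth fps_mult_of_nat_nth(1) del: power_Suc binomial_Suc_Suc)
  also have "\<dots> = (\<Sum>k = 0..(n - 1) div 2. real (Suc n choose (n - 2 * k)) * geo2 (n - 2 * k) $ (2 * k))"
  proof (rule sum.mono_neutral_cong_right[THEN trans])
    let ?M = "(\<lambda>k. n - 2 * k) ` {0..(n - 1) div 2}"
    show "?M \<subseteq> {..Suc n}" by auto
    show "\<forall>m\<in>{..Suc n} - ?M. real (Suc n choose m) * (if n < m then 0 else geo2 m $ (n - m)) = 0"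
    proof
      fix m assume m: "m \<in> {..Suc n} - ?M"
      have "geo2 m $ (n - m) = 0" if "m \<le> n"
      proof (cases "even (n - m)")
        case True
        then obtain k where k: "n - m = 2 * k" by (elim evenE)
        then have "m = n - 2 * k" using that by simp
        with m have "\<not> k \<le> (n - 1) div 2" by auto
        \<comment> \<open>Outside the index range only \<open>m = 0\<close> remains, and
          \<open>geo2 0 = 1\<close> has coefficient 0 in the positive degree
          \<open>n\<close>.\<close>
        with k assms have "m = 0" "n = 2 * k" by auto
        then show ?thesis using k assms by (simp add: geo2_def)
      qed (simp add: geo2_def)
      then show "real (Suc n choose m) * (if n < m then 0 else geo2 m $ (n - m)) = 0" by simp
    qed
    show "(\<Sum>m\<in>?M. real (Suc n choose m) * geo2 m $ (n - m)) =
      (\<Sum>k = 0..(n - 1) div 2. real (Suc n choose (n - 2 * k)) * geo2 (n - 2 * k) $ (2 * k))"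
      using assms by (subst sum.reindex) (auto intro!: sum.cong inj_onI)
  qed auto
  also have "\<dots> = (\<Sum>k = 0..(n - 1) div 2. real (Suc n choose (2 * k + 1)) * real ((n - k - 1) choose k))"
  proof (rule sum.cong)
    fix k assume "k \<in> {0..(n - 1) div 2}"
    then have k: "2 * k + 1 \<le> n" using assms by auto
    have "Suc n choose (n - 2 * k) = Suc n choose (2 * k + 1)"
      using binomial_symmetric[of "2 * k + 1" "Suc n"] k by simp
    moreover have "geo2 (n - 2 * k) $ (2 * k) = real ((n - k - 1) choose k)"
    proof -
      have "k + (n - 2 * k) - 1 = n - k - 1" using k by simp
      then show ?thesis by (simp add: geo2_def)
    qed
    ultimately show "real (Suc n choose (n - 2 * k)) * geo2 (n - 2 * k) $ (2 * k) =
        real (Suc n choose (2 * k + 1)) * real ((n - k - 1) choose k)" by simp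
  qed simp
  finally show ?thesis .
qed

section \<open>The cycle lemma and the cutting of paths\<close>

text \<open>By the cycle lemma, a proportion \<open>h / N\<close> of the sequences of \<open>N\<close> steps \<open>1 - e\<close> that end
  at height \<open>h\<close> has only positive partial sums. Such sequences are the initial parts of paths,
  with one up step prepended.\<close>
definition heads :: "nat \<Rightarrow> nat \<Rightarrow> real" where
  "heads N h = real h / real N * (phi ^ N) $ (N - h)"

text \<open>Undoing a last step \<open>1 - e\<close> leads from height \<open>Suc h\<close> to
  \<open>h + e\<close>, which \<open>N\<close> steps reach only for \<open>e \<le> N - h\<close>.
  This recurrence serves as an algebraic form of the cycle lemma.\<close>

lemma heads_Suc:
  assumes "N \<ge> 1" "h \<le> N"
  shows "heads (Suc N) (Suc h) = (\<Sum>e\<le>N - h. phi $ e * heads N (h + e))"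
proof -
  define c where "c = (phi ^ Suc N) $ (N - h)"
  \<comment> \<open>The sum weighted by \<open>e\<close> comes from comparing coefficients in
    \<open>x * (phi ^ (N + 1))' = (N + 1) * x * phi' * phi ^ N\<close>.\<close>
  have deriv: "real (N - h) * c = real (Suc N) * (\<Sum>e\<le>N - h. real e * phi $ e * (phi ^ N) $ (N - h - e))"
  proof -
    have "fps_X * fps_deriv (phi ^ Suc N) = of_nat (Suc N) * ((fps_X * fps_deriv phi) * phi ^ N)"
      unfolding fps_deriv_power' diff_Suc_1 by (simp only: ac_simps)
    then have "(fps_X * fps_deriv (phi ^ Suc N)) $ (N - h) =
        real (Suc N) * ((fps_X * fps_deriv phi) * phi ^ N) $ (N - h)"
      by (metis fps_mult_of_nat_nth(1))
    moreover have nth: "(fps_X * fps_deriv f) $ i = real i * f $ i" for f :: "real fps" and i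
      by (cases i) simp_all
    ultimately show ?thesis
      unfolding nth c_def fps_mult_nth[of "fps_X * fps_deriv phi"] by (simp add: atLeast0AtMost)
  qed
  \<comment> \<open>The factor \<open>h + e\<close> in \<open>heads N (h + e)\<close> splits: the
    part with \<open>h\<close> yields \<open>h * c\<close>, the part with \<open>e\<close> is given
    by \<open>deriv\<close>.\<close>
  have "(\<Sum>e\<le>N - h. phi $ e * heads N (h + e)) =
      (\<Sum>e\<le>N - h. (real h * (phi $ e * (phi ^ N) $ (N - h - e))
                     + real e * phi $ e * (phi ^ N) $ (N - h - e)) / real N)"
    by (intro sum.cong) (simp_all add: heads_def field_simps)
  also have "\<dots> = (real h * c + (\<Sum>e\<le>N - h. real e * phi $ e * (phi ^ N) $ (N - h - e))) / real N"
    unfolding sum_divide_distrib[symmetric] sum.distrib sum_distrib_left[symmetric]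
    by (simp add: c_def fps_mult_nth atLeast0AtMost)
  also have "\<dots> = (real h * c + real (N - h) * c / real (Suc N)) / real N"
    unfolding deriv by (simp del: of_nat_Suc)
  also have "\<dots> = real (Suc h) / real (Suc N) * c"
  proof -
    have "real h * c + real (N - h) * c / real (Suc N) = real N * (real (Suc h) / real (Suc N) * c)"
      using assms by (simp add: of_nat_diff divide_simps) (simp add: algebra_simps)
    then show ?thesis using assms by simp
  qed
  finally show ?thesis
    by (simp add: heads_def c_def)
qed

lemma tails_Suc: "real (tails (Suc b) h) = (\<Sum>e\<le>Suc h. phi $ e * real (tails b (Suc h - e)))"
proof -
  have "(\<Sum>e\<le>Suc h. phi $ e * real (tails b (Suc h - e))) =
      real (tails b (Suc h)) + (\<Sum>j\<le>h. phi $ Suc j * real (tails b (h - j)))"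
    by (subst sum.atMost_Suc_shift) (simp add: phi_nth)
  also have "(\<Sum>j\<le>h. phi $ Suc j * real (tails b (h - j))) = (\<Sum>j | j \<le> h \<and> even j. real (tails b (h - j)))"
    by (intro sum.mono_neutral_cong_right) (auto simp: phi_nth)
  finally show ?thesis by simp
qed

text \<open>A lattice path is cut after \<open>t\<close> up steps: \<^const>\<open>heads\<close> counts the initial parts and
  \<^const>\<open>tails\<close> the final parts.\<close>
lemma tails_eq_sum_heads:
  "t \<le> n \<Longrightarrow> real (tails n 0) = (\<Sum>h\<le>t. heads (Suc t) (Suc h) * real (tails (n - t) h))"
proof (induction t)
  case 0
  \<comment> \<open>Only the prepended up step is present: \<open>heads 1 1 = 1\<close>.\<close>
  then show ?case by (simp add: heads_def phi_nth)
next
  case (Suc t)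
  define b where "b = n - Suc t"
  have b: "n - t = Suc b" using Suc.prems by (simp add: b_def)
  let ?g = "\<lambda>e h. heads (Suc t) (e + h) * (phi $ e * real (tails b h))"
  have "real (tails n 0) = (\<Sum>h\<le>t. heads (Suc t) (Suc h) * real (tails (Suc b) h))"
    using Suc by (simp add: b)
  \<comment> \<open>The new term \<open>k = 0\<close> vanishes because
    \<open>heads (Suc t) 0 = 0\<close>.\<close>
  also have "\<dots> = (\<Sum>k\<le>Suc t. heads (Suc t) k * (\<Sum>e\<le>k. phi $ e * real (tails b (k - e))))"
    unfolding tails_Suc by (subst (2) sum.atMost_Suc_shift) (simp add: heads_def)
  also have "\<dots> = (\<Sum>k\<le>Suc t. \<Sum>e\<le>k. ?g e (k - e))"
    by (simp add: sum_distrib_left)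
  \<comment> \<open>Exchanging the sums over the triangle makes the inner sum the one in
    \<open>heads_Suc\<close>.\<close>
  also have "\<dots> = (\<Sum>(e, h) | e + h \<le> Suc t. ?g e h)"
    by (rule sum.triangle_reindex_eq[symmetric])
  also have "\<dots> = (\<Sum>(h, e) \<in> (SIGMA h:{..Suc t}. {..Suc t - h}). ?g e h)"
    by (rule sum.reindex_bij_witness[of _ prod.swap prod.swap]) auto
  also have "\<dots> = (\<Sum>h\<le>Suc t. \<Sum>e\<le>Suc t - h. ?g e h)"
    by (rule sum.Sigma[symmetric]) auto
  also have "\<dots> = (\<Sum>h\<le>Suc t. heads (Suc (Suc t)) (Suc h) * real (tails b h))"
  proof (rule sum.cong)
    fix h assume "h \<in> {..Suc t}"
    then have "heads (Suc (Suc t)) (Suc h) = (\<Sum>e\<le>Suc t - h. phi $ e * heads (Suc t) (h + e))"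
      by (intro heads_Suc) auto
    then show "(\<Sum>e\<le>Suc t - h. ?g e h) = heads (Suc (Suc t)) (Suc h) * real (tails b h)"
      by (simp only: sum_distrib_right) (intro sum.cong refl, simp only: ac_simps)
  qed simp
  finally show ?case by (simp add: b_def)
qed

section \<open>Evaluation of the count\<close>

theorem theorem6p1:
  fixes n :: nat
  assumes "n \<ge> 1"
  shows "real (num_jacobi_avoiding n [1, 2, 3]) =
    (\<Sum>k = 0..(n - 1) div 2.
       1 / real (2 * k + 1) * real ((n - k - 1) choose k) * real (n choose (2 * k)))"
proof -
  have "real (num_jacobi_avoiding n [1, 2, 3]) = (\<Sum>h\<le>n. heads (Suc n) (Suc h) * real (tails 0 h))"
    unfolding num_jacobi_avoiding_123 using tails_eq_sum_heads[of n n] by simp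
  \<comment> \<open>Complete paths end at height 0: \<open>tails 0 h = 0\<close> for
    \<open>h > 0\<close>.\<close>
  also have "\<dots> = (\<Sum>h\<in>{0}. heads (Suc n) (Suc h) * real (tails 0 h))"
    by (intro sum.mono_neutral_right) auto
  also have "\<dots> = (phi ^ Suc n) $ n / real (Suc n)"
    by (simp add: heads_def del: power_Suc)
  also have "\<dots> = (\<Sum>k = 0..(n - 1) div 2.
      real (Suc n choose (2 * k + 1)) * real ((n - k - 1) choose k) / real (Suc n))"
    unfolding phi_power_nth[OF assms] sum_divide_distrib ..
  also have "\<dots> = (\<Sum>k = 0..(n - 1) div 2.
      1 / real (2 * k + 1) * real ((n - k - 1) choose k) * real (n choose (2 * k)))"
  proof (rule sum.cong)
    fix k
    \<comment> \<open>The absorption identity trades the factor \<open>1 / (n + 1)\<close> for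
      \<open>1 / (2 * k + 1)\<close>.\<close>
    have "real (2 * k + 1) * real (Suc n choose (2 * k + 1)) = real (Suc n) * real (n choose (2 * k))"
      using Suc_times_binomial[of "2 * k" n] by (metis Suc_eq_plus1 of_nat_mult)
    then have "real (Suc n choose (2 * k + 1)) / real (Suc n) = real (n choose (2 * k)) / real (2 * k + 1)"
      by (simp add: frac_eq_eq mult.commute del: binomial_Suc_Suc of_nat_Suc of_nat_add)
    then have "real (Suc n choose (2 * k + 1)) / real (Suc n) * real ((n - k - 1) choose k) =
        real (n choose (2 * k)) / real (2 * k + 1) * real ((n - k - 1) choose k)"
      by (simp only:)
    then show "real (Suc n choose (2 * k + 1)) * real ((n - k - 1) choose k) / real (Suc n) =
        1 / real (2 * k + 1) * real ((n - k - 1) choose k) * real (n choose (2 * k))"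
      by (simp add: mult_ac del: binomial_Suc_Suc of_nat_Suc of_nat_add)
  qed simp
  finally show ?thesis .
qed

end
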